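(* Let $p_1,p_2$ be transcendental periods with $\deg(p_1)\ne\deg(p_2)$. Then both $p_1/p_2$ and $p_1+p_2$ are transcendental numbers.
   Context: Let $\overline{\mathbb{Q}}$ denote the field of algebraic numbers. For $n\ge 1$, an admissible domain in $\mathbb{R}^n$ is a subset of $\mathbb{R}^n$ which is a finite union of sets of the form $\{x\in\mathbb{R}^n : P_1(x)\,\square_1\, 0,\dots,P_r(x)\,\square_r\, 0\}$, where each $P_i$ is a polynomial with real algebraic coefficients and each $\square_i\in\{\ge,>\}$, and which has finite Lebesgue measure $\mathrm{vol}_n$. A real number $p$ is a real period if $p=\mathrm{vol}_n(\Sigma_1)-\mathrm{vol}_n(\Sigma_2)$ for some $n\ge1$ and admissible domains $\Sigma_1,\Sigma_2\subseteq\mathbb{R}^n$; a complex number is a period if its real and imaginary parts are real periods. The degree is defined as follows: $\deg(0)=0$; for a nonzero real period $p$, $\deg(p)$ is the least $n\ge 1$ such that $p=\mathrm{vol}_n(\Sigma_1)-\mathrm{vol}_n(\Sigma_2)$ with $\Sigma_1,\Sigma_2$ admissible domains in $\mathbb{R}^n$; for a complex period $p=a+ib$ ($a,b$ real), $\deg(p)=\max(\deg(a),\deg(b))$; for a complex number that is not a period, $\deg(p)=\infty$, with $\infty$ larger than every integer. *)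

theory Defs
  imports "HOL-Analysis.Analysis" "HOL-Probability.Probability" "HOL-Computational_Algebra.Polynomial"
begin

definition Rn :: "nat \<Rightarrow> (nat \<Rightarrow> real) set" where
  "Rn n = PiE {..<n} (\<lambda>_. UNIV)"

definition lebesgue_n :: "nat \<Rightarrow> (nat \<Rightarrow> real) measure" where
  "lebesgue_n n = PiM {..<n} (\<lambda>_. lborel)"

definition alg_mpoly :: "nat \<Rightarrow> ((nat \<Rightarrow> real) \<Rightarrow> real) \<Rightarrow> bool" where
  "alg_mpoly n P \<longleftrightarrow>
     (\<exists>(M :: (nat \<Rightarrow> nat) set) (c :: (nat \<Rightarrow> nat) \<Rightarrow> real).
        finite M \<and> (\<forall>m\<in>M. algebraic (c m)) \<and>
        (\<forall>x. P x = (\<Sum>m\<in>M. c m * (\<Prod>i<n. x i ^ m i))))"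

definition basic_set :: "nat \<Rightarrow> (((nat \<Rightarrow> real) \<Rightarrow> real) \<times> bool) list \<Rightarrow> (nat \<Rightarrow> real) set" where
  "basic_set n L = {x \<in> Rn n. \<forall>(P, strict) \<in> set L. if strict then P x > 0 else P x \<ge> 0}"

definition admissible_domain :: "nat \<Rightarrow> (nat \<Rightarrow> real) set \<Rightarrow> bool" where
  "admissible_domain n \<Sigma> \<longleftrightarrow>
     (\<exists>Ls :: (((nat \<Rightarrow> real) \<Rightarrow> real) \<times> bool) list list.
        (\<forall>L\<in>set Ls. \<forall>(P, _) \<in> set L. alg_mpoly n P) \<and>
        \<Sigma> = (\<Union>L\<in>set Ls. basic_set n L)) \<and>
     emeasure (lebesgue_n n) \<Sigma> < \<infinity>"

definition vol :: "nat \<Rightarrow> (nat \<Rightarrow> real) set \<Rightarrow> real" where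
  "vol n \<Sigma> = measure (lebesgue_n n) \<Sigma>"

definition period_in_dim :: "nat \<Rightarrow> real \<Rightarrow> bool" where
  "period_in_dim n p \<longleftrightarrow>
     (\<exists>\<Sigma>1 \<Sigma>2. admissible_domain n \<Sigma>1 \<and> admissible_domain n \<Sigma>2 \<and> p = vol n \<Sigma>1 - vol n \<Sigma>2)"

definition real_period :: "real \<Rightarrow> bool" where
  "real_period p \<longleftrightarrow> (\<exists>n\<ge>1. period_in_dim n p)"

definition period :: "complex \<Rightarrow> bool" where
  "period z \<longleftrightarrow> real_period (Re z) \<and> real_period (Im z)"

definition real_period_deg :: "real \<Rightarrow> nat" where
  "real_period_deg p = (if p = 0 then 0 else (LEAST n. n \<ge> 1 \<and> period_in_dim n p))"

definition period_deg :: "complex \<Rightarrow> enat" where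
  "period_deg z = (if z = 0 then 0
     else if period z then enat (max (real_period_deg (Re z)) (real_period_deg (Im z)))
     else \<infinity>)"

end

theory Submission
  imports Defs
begin

text \<open>For fixed \<open>n \<ge> 1\<close>, the differences of volumes of admissible domains in dimension \<open>n\<close> form a vector
  space over the real algebraic numbers that contains these numbers, and the spaces grow with \<open>n\<close>.
  Adding volumes amounts to making two domains disjoint without leaving the dimension, by piecewise
  linear maps that preserve the volume. Taking real and imaginary parts, the degree of \<open>a z + b\<close> with
  \<open>a, b\<close> algebraic is at most that of a period \<open>z \<noteq> 0\<close>. If \<open>p1 / p2\<close> or \<open>p1 + p2\<close> were algebraic, each of
  \<open>p1\<close> and \<open>p2\<close> would be such an affine image of the other, so their degrees would agree.\<close>

subsection \<open>The field of algebraic numbers\<close>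

text \<open>Closure of algebraic numbers under addition and multiplication is proved by linear
  algebra: a number is algebraic iff its powers span a finite-dimensional space over the rationals.
  This makes the theory of span and dimension available over \<open>rat\<close>.\<close>

interpretation rat_span: vector_space "\<lambda>(q::rat) (x::'a::field_char_0). of_rat q * x"
  by standard (auto simp: algebra_simps of_rat_add of_rat_mult)

lemma rat_span_mult:
  fixes x y :: "'a::field_char_0"
  assumes "x \<in> rat_span.span S" "y \<in> rat_span.span T"
  shows "x * y \<in> rat_span.span ((\<lambda>(s, t). s * t) ` (S \<times> T))"
  using assms(1)
proof (induction rule: rat_span.span_induct_alt)
  case base
  then show ?case by (simp add: rat_span.span_zero)
next
  case (step c s u)
  have "s * y \<in> rat_span.span ((\<lambda>(s, t). s * t) ` (S \<times> T))"
    using assms(2)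
  proof (induction rule: rat_span.span_induct_alt)
    case base
    then show ?case by (simp add: rat_span.span_zero)
  next
    case (step d t v)
    then have "s * t \<in> (\<lambda>(s, t). s * t) ` (S \<times> T)" using \<open>s \<in> S\<close> by auto
    from rat_span.span_add[OF rat_span.span_scale[OF rat_span.span_base[OF this], of d] step(2)]
    show ?case by (simp add: algebra_simps)
  qed
  from rat_span.span_add[OF rat_span.span_scale[OF this, of c] step(2)]
  show ?case by (simp add: algebra_simps)
qed

lemma rat_span_of_rat_mult: "q \<in> \<rat> \<Longrightarrow> x \<in> rat_span.span S \<Longrightarrow> q * x \<in> rat_span.span S"
  by (metis Rats_cases rat_span.span_scale)

text \<open>An annihilating polynomial of degree \<open>d\<close>, solved for its leading term,
  writes \<open>x ^ d\<close> through lower powers; strong induction then reduces every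
  power.\<close>

lemma algebraic_powers_in_rat_span:
  fixes x :: "'a::field_char_0"
  assumes "algebraic x"
  obtains d where "\<And>k. x ^ k \<in> rat_span.span ((\<lambda>i. x ^ i) ` {..<d})"
proof -
  obtain p where p: "\<And>i. coeff p i \<in> \<rat>" "p \<noteq> 0" "poly p x = 0"
    using assms unfolding algebraic_altdef by blast
  define d where "d = degree p"
  have lc: "coeff p d \<noteq> 0" using p(2) by (simp add: d_def)
  have "(\<Sum>i\<le>d. coeff p i * x ^ i) = 0" using p(3) by (simp add: poly_altdef d_def)
  then have "(\<Sum>i<d. coeff p i * x ^ i) + coeff p d * x ^ d = 0"
    by (simp flip: lessThan_Suc_atMost)
  then have xd: "x ^ d = (\<Sum>i<d. (- coeff p i / coeff p d) * x ^ i)"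
    using lc by (simp add: field_simps sum_negf sum_divide_distrib[symmetric] eq_neg_iff_add_eq_0)
  have "x ^ k \<in> rat_span.span ((\<lambda>i. x ^ i) ` {..<d})" for k
  proof (induction k rule: less_induct)
    case (less k)
    show ?case
    proof (cases "k < d")
      case True
      then show ?thesis by (intro rat_span.span_base) auto
    next
      case False
      then have "x ^ k = x ^ (k - d) * x ^ d" by (simp flip: power_add)
      also have "\<dots> = (\<Sum>i<d. (- coeff p i / coeff p d) * x ^ (k - d + i))"
        by (simp add: xd sum_distrib_left power_add mult_ac)
      also have "\<dots> \<in> rat_span.span ((\<lambda>i. x ^ i) ` {..<d})"
        using False p(1) by (intro rat_span.span_sum rat_span_of_rat_mult less) auto
      finally show ?thesis .
    qed
  qed
  then show thesis using that by blast
qed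

text \<open>Among \<open>card B + 1\<close> vectors in a space spanned by \<open>card B\<close>
  elements there is a linear relation; between powers of \<open>x\<close> this relation is a
  polynomial equation.\<close>

lemma algebraic_if_powers_in_rat_span:
  fixes x :: "'a::field_char_0"
  assumes "finite B" "\<And>k. x ^ k \<in> rat_span.span B"
  shows "algebraic x"
\<comment> \<open>The dimension bound counts sets, so repeated powers are treated separately: they
  already give the equation \<open>x ^ i - x ^ j = 0\<close>.\<close>
proof (cases "inj_on (\<lambda>k. x ^ k) {..card B}")
  case False
  then obtain i j where ij: "i \<noteq> j" "x ^ i = x ^ j" by (auto simp: inj_on_def)
  define p :: "'a poly" where "p = monom 1 i - monom 1 j"
  have "coeff p i = 1" using ij by (simp add: p_def)
  then have "p \<noteq> 0" by auto
  moreover have "poly p x = 0" using ij by (simp add: p_def poly_monom)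
  moreover have "coeff p k \<in> \<rat>" for k by (auto simp: p_def)
  ultimately show ?thesis by (intro algebraicI'[of p])
next
  case True
  let ?S = "(\<lambda>k. x ^ k) ` {..card B}"
  have "rat_span.dependent ?S"
    using rat_span.independent_span_bound[OF assms(1), of ?S] assms(2) True
    by (auto simp: card_image)
  then obtain u v where u: "(\<Sum>v\<in>?S. of_rat (u v) * v) = 0" "v \<in> ?S" "u v \<noteq> 0"
    by (auto simp: rat_span.dependent_finite)
  \<comment> \<open>The relation \<open>u\<close> is indexed by the vectors themselves, so the
    coefficient in degree \<open>k\<close> is \<open>u\<close> at \<open>x ^ k\<close>; injectivity
    allows the later reindexing.\<close>
  define p where "p = (\<Sum>k\<le>card B. monom (of_rat (u (x ^ k))) k :: 'a poly)"
  obtain k where k: "k \<le> card B" "v = x ^ k" using u(2) by auto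
  have c: "coeff p i = (if i \<le> card B then of_rat (u (x ^ i)) else 0)" for i
    by (simp add: p_def coeff_sum)
  have "p \<noteq> 0" using c[of k] k u(3) by auto
  moreover have "poly p x = 0" using u(1) True
    by (simp add: p_def poly_sum poly_monom sum.reindex)
  moreover have "coeff p i \<in> \<rat>" for i by (simp add: c)
  ultimately show ?thesis by (intro algebraicI'[of p])
qed

text \<open>All powers of the sum and of the product lie in the span of the finitely many products
  \<open>x ^ i * y ^ j\<close> with \<open>i < d\<close> and \<open>j < e\<close>.\<close>

lemma
  fixes x y :: "'a::field_char_0"
  assumes "algebraic x" "algebraic y"
  shows algebraic_add [intro]: "algebraic (x + y)" and algebraic_mult [intro]: "algebraic (x * y)"
proof -
  obtain d where d: "\<And>k. x ^ k \<in> rat_span.span ((\<lambda>i. x ^ i) ` {..<d})"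
    using algebraic_powers_in_rat_span assms(1) by blast
  obtain e where e: "\<And>k. y ^ k \<in> rat_span.span ((\<lambda>i. y ^ i) ` {..<e})"
    using algebraic_powers_in_rat_span assms(2) by blast
  let ?B = "(\<lambda>(s, t). s * t) ` (((\<lambda>i. x ^ i) ` {..<d}) \<times> ((\<lambda>i. y ^ i) ` {..<e}))"
  note xy = rat_span_mult[OF d e]
  have "(x + y) ^ k \<in> rat_span.span ?B" for k
    unfolding binomial_ring mult.assoc
    by (intro rat_span.span_sum rat_span_of_rat_mult xy) auto
  then show "algebraic (x + y)" by (rule algebraic_if_powers_in_rat_span[rotated]) auto
  have "(x * y) ^ k \<in> rat_span.span ?B" for k
    unfolding power_mult_distrib by (rule xy)
  then show "algebraic (x * y)" by (rule algebraic_if_powers_in_rat_span[rotated]) auto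
qed

text \<open>The real part is half the sum of \<open>z\<close> and its conjugate, which is also
  algebraic.\<close>

lemma algebraic_Re [intro]: "algebraic z \<Longrightarrow> algebraic (Re z)"
proof -
  assume "algebraic z"
  moreover have "complex_of_real (Re z) = (z + cnj z) * inverse 2"
    by (simp add: complex_eq_iff)
  ultimately have "algebraic (complex_of_real (Re z))"
    by (metis algebraic_add algebraic_cnj algebraic_inverse algebraic_mult algebraic_numeral)
  then show ?thesis by simp
qed

lemma algebraic_Im [intro]: "algebraic z \<Longrightarrow> algebraic (Im z)"
  using algebraic_Re[of "- \<i> * z"] by auto

subsection \<open>Semialgebraic sets\<close>

lemma alg_mpoly_monomial:
  assumes "algebraic c"
  shows "alg_mpoly n (\<lambda>x. c * (\<Prod>i<n. x i ^ m i))"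
  unfolding alg_mpoly_def using assms by (intro exI[of _ "{m}"] exI[of _ "\<lambda>_. c"]) auto

lemma alg_mpoly_const: "algebraic c \<Longrightarrow> alg_mpoly n (\<lambda>_. c)"
  using alg_mpoly_monomial[of c n "\<lambda>_. 0"] by simp

lemma alg_mpoly_coord:
  assumes "k < n"
  shows "alg_mpoly n (\<lambda>x. x k)"
proof -
  have "(\<Prod>i<n. x i ^ (if i = k then 1 else 0)) = x k" for x :: "nat \<Rightarrow> real"
    using assms by (simp add: if_distrib[of "\<lambda>e. _ ^ e"] cong: if_cong)
  then show ?thesis
    using alg_mpoly_monomial[of 1 n "\<lambda>i. if i = k then 1 else 0"] by simp
qed

lemma alg_mpoly_add:
  assumes "alg_mpoly n P" "alg_mpoly n Q"
  shows "alg_mpoly n (\<lambda>x. P x + Q x)"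
proof -
  obtain M c where P: "finite M" "\<forall>m\<in>M. algebraic (c m)"
    "\<And>x. P x = (\<Sum>m\<in>M. c m * (\<Prod>i<n. x i ^ m i))"
    using assms(1) unfolding alg_mpoly_def by blast
  obtain M' c' where Q: "finite M'" "\<forall>m\<in>M'. algebraic (c' m)"
    "\<And>x. Q x = (\<Sum>m\<in>M'. c' m * (\<Prod>i<n. x i ^ m i))"
    using assms(2) unfolding alg_mpoly_def by blast
  \<comment> \<open>The exponent sets \<open>M\<close> and \<open>M'\<close> may overlap, so both
    sums are first padded with zero coefficients to the union.\<close>
  let ?c = "\<lambda>m. (if m \<in> M then c m else 0) + (if m \<in> M' then c' m else 0)"
  have 1: "(\<Sum>m\<in>M. c m * (\<Prod>i<n. x i ^ m i)) =
    (\<Sum>m\<in>M \<union> M'. (if m \<in> M then c m else 0) * (\<Prod>i<n. x i ^ m i))" for x :: "nat \<Rightarrow> real"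
    using P(1) Q(1) by (intro sum.mono_neutral_cong_left) auto
  have 2: "(\<Sum>m\<in>M'. c' m * (\<Prod>i<n. x i ^ m i)) =
    (\<Sum>m\<in>M \<union> M'. (if m \<in> M' then c' m else 0) * (\<Prod>i<n. x i ^ m i))" for x :: "nat \<Rightarrow> real"
    using P(1) Q(1) by (intro sum.mono_neutral_cong_left) auto
  have "P x + Q x = (\<Sum>m\<in>M \<union> M'. ?c m * (\<Prod>i<n. x i ^ m i))" for x
    unfolding P(3) Q(3) 1 2 by (simp add: distrib_right sum.distrib)
  moreover have "\<forall>m\<in>M \<union> M'. algebraic (?c m)"
    using P(2) Q(2) by (auto intro!: algebraic_add)
  ultimately show ?thesis
    unfolding alg_mpoly_def using P(1) Q(1) by (intro exI[of _ "M \<union> M'"] exI[of _ ?c]) blast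
qed

lemma alg_mpoly_sum:
  assumes "\<And>a. a \<in> A \<Longrightarrow> alg_mpoly n (P a)"
  shows "alg_mpoly n (\<lambda>x. \<Sum>a\<in>A. P a x)"
  using assms
  by (induction A rule: infinite_finite_induct) (auto intro: alg_mpoly_add alg_mpoly_const)

lemma alg_mpoly_mult:
  assumes "alg_mpoly n P" "alg_mpoly n Q"
  shows "alg_mpoly n (\<lambda>x. P x * Q x)"
proof -
  obtain M c where P: "finite M" "\<forall>m\<in>M. algebraic (c m)"
    "\<And>x. P x = (\<Sum>m\<in>M. c m * (\<Prod>i<n. x i ^ m i))"
    using assms(1) unfolding alg_mpoly_def by blast
  obtain M' c' where Q: "finite M'" "\<forall>m\<in>M'. algebraic (c' m)"
    "\<And>x. Q x = (\<Sum>m\<in>M'. c' m * (\<Prod>i<n. x i ^ m i))"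
    using assms(2) unfolding alg_mpoly_def by blast
  \<comment> \<open>Different pairs of exponents may have the same sum. Reading the product as a sum
    of monomials leaves the collection of like terms to \<open>alg_mpoly_sum\<close>.\<close>
  have "P x * Q x = (\<Sum>m\<in>M. \<Sum>m'\<in>M'. (c m * c' m') * (\<Prod>i<n. x i ^ (m i + m' i)))" for x
    unfolding P(3) Q(3) sum_product by (simp add: power_add prod.distrib mult_ac)
  moreover have "alg_mpoly n (\<lambda>x. \<Sum>m\<in>M. \<Sum>m'\<in>M'. (c m * c' m') * (\<Prod>i<n. x i ^ (m i + m' i)))"
    using P(2) Q(2) by (intro alg_mpoly_sum alg_mpoly_monomial) auto
  ultimately show ?thesis by presburger
qed

lemma alg_mpoly_minus: "alg_mpoly n P \<Longrightarrow> alg_mpoly n (\<lambda>x. - P x)"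
  using alg_mpoly_mult[OF alg_mpoly_const[of "-1" n]] by simp

lemma alg_mpoly_diff: "alg_mpoly n P \<Longrightarrow> alg_mpoly n Q \<Longrightarrow> alg_mpoly n (\<lambda>x. P x - Q x)"
  using alg_mpoly_add[OF _ alg_mpoly_minus] by simp

lemma alg_mpoly_power: "alg_mpoly n P \<Longrightarrow> alg_mpoly n (\<lambda>x. P x ^ k)"
  by (induction k) (auto intro: alg_mpoly_mult alg_mpoly_const)

lemma alg_mpoly_prod:
  assumes "\<And>a. a \<in> A \<Longrightarrow> alg_mpoly n (P a)"
  shows "alg_mpoly n (\<lambda>x. \<Prod>a\<in>A. P a x)"
  using assms
  by (induction A rule: infinite_finite_induct) (auto intro: alg_mpoly_mult alg_mpoly_const)

lemma alg_mpoly_subst: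
  assumes "alg_mpoly n P" "\<And>i. i < n \<Longrightarrow> alg_mpoly m (\<lambda>x. g x i)"
  shows "alg_mpoly m (\<lambda>x. P (g x))"
proof -
  obtain M c where P: "finite M" "\<forall>m\<in>M. algebraic (c m)"
    "\<And>x. P x = (\<Sum>m\<in>M. c m * (\<Prod>i<n. x i ^ m i))"
    using assms(1) unfolding alg_mpoly_def by blast
  show ?thesis unfolding P(3) using P(2) assms(2)
    by (auto intro!: alg_mpoly_sum alg_mpoly_mult alg_mpoly_const alg_mpoly_prod alg_mpoly_power)
qed

lemma borel_measurable_alg_mpoly:
  assumes "alg_mpoly n P"
  shows "P \<in> borel_measurable (lebesgue_n n)"
proof -
  obtain M c where P: "finite M" "\<forall>m\<in>M. algebraic (c m)"
    "\<And>x. P x = (\<Sum>m\<in>M. c m * (\<Prod>i<n. x i ^ m i))"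
    using assms unfolding alg_mpoly_def by blast
  have [measurable]: "(\<lambda>x. x i) \<in> borel_measurable (lebesgue_n n)" if "i < n" for i
    using that measurable_component_singleton[of i "{..<n}" "\<lambda>_. lborel"]
    by (simp add: lebesgue_n_def)
  show ?thesis unfolding P(3)[abs_def] by measurable
qed

text \<open>Admissibility without finite volume, so that half-spaces and other unbounded pieces can
  serve as building blocks.\<close>

definition semialgebraic :: "nat \<Rightarrow> (nat \<Rightarrow> real) set \<Rightarrow> bool" where
  "semialgebraic n S \<longleftrightarrow>
     (\<exists>Ls. (\<forall>L\<in>set Ls. \<forall>(P, _)\<in>set L. alg_mpoly n P) \<and> S = (\<Union>L\<in>set Ls. basic_set n L))"

lemma admissible_domain_iff:
  "admissible_domain n S \<longleftrightarrow> semialgebraic n S \<and> emeasure (lebesgue_n n) S < \<infinity>"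
  unfolding admissible_domain_def semialgebraic_def ..

lemma semialgebraic_subset: "semialgebraic n S \<Longrightarrow> S \<subseteq> Rn n"
  by (auto simp: semialgebraic_def basic_set_def)

lemma semialgebraic_empty: "semialgebraic n {}"
  unfolding semialgebraic_def by (intro exI[of _ "[]"]) auto

lemma semialgebraic_basic_set:
  assumes "\<And>P b. (P, b) \<in> set L \<Longrightarrow> alg_mpoly n P"
  shows "semialgebraic n (basic_set n L)"
  unfolding semialgebraic_def using assms by (intro exI[of _ "[L]"]) auto

lemma semialgebraic_Rn: "semialgebraic n (Rn n)"
  using semialgebraic_basic_set[of "[]" n] by (simp add: basic_set_def)

lemma semialgebraic_pos: "alg_mpoly n P \<Longrightarrow> semialgebraic n {x \<in> Rn n. P x > 0}"
  using semialgebraic_basic_set[of "[(P, True)]" n] by (simp add: basic_set_def)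

lemma semialgebraic_nonneg: "alg_mpoly n P \<Longrightarrow> semialgebraic n {x \<in> Rn n. P x \<ge> 0}"
  using semialgebraic_basic_set[of "[(P, False)]" n] by (simp add: basic_set_def)

lemma semialgebraic_Un:
  assumes "semialgebraic n S" "semialgebraic n T"
  shows "semialgebraic n (S \<union> T)"
proof -
  obtain Ls where "\<forall>L\<in>set Ls. \<forall>(P, _)\<in>set L. alg_mpoly n P" "S = (\<Union>L\<in>set Ls. basic_set n L)"
    using assms(1) unfolding semialgebraic_def by blast
  moreover obtain Ks where "\<forall>L\<in>set Ks. \<forall>(P, _)\<in>set L. alg_mpoly n P" "T = (\<Union>L\<in>set Ks. basic_set n L)"
    using assms(2) unfolding semialgebraic_def by blast
  ultimately show ?thesis
    unfolding semialgebraic_def by (intro exI[of _ "Ls @ Ks"]) auto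
qed

lemma semialgebraic_UN:
  assumes "finite I" "\<And>i. i \<in> I \<Longrightarrow> semialgebraic n (S i)"
  shows "semialgebraic n (\<Union>i\<in>I. S i)"
  using assms by (induction I rule: finite_induct) (auto intro: semialgebraic_empty semialgebraic_Un)

lemma basic_set_append: "basic_set n (L @ K) = basic_set n L \<inter> basic_set n K"
  by (auto simp: basic_set_def)

lemma semialgebraic_Int:
  assumes "semialgebraic n S" "semialgebraic n T"
  shows "semialgebraic n (S \<inter> T)"
proof -
  obtain Ls where Ls: "\<forall>L\<in>set Ls. \<forall>(P, _)\<in>set L. alg_mpoly n P" "S = (\<Union>L\<in>set Ls. basic_set n L)"
    using assms(1) unfolding semialgebraic_def by blast
  obtain Ks where Ks: "\<forall>L\<in>set Ks. \<forall>(P, _)\<in>set L. alg_mpoly n P" "T = (\<Union>L\<in>set Ks. basic_set n L)"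
    using assms(2) unfolding semialgebraic_def by blast
  have "S \<inter> T = (\<Union>L\<in>set Ls. \<Union>K\<in>set Ks. basic_set n (L @ K))"
    using Ls(2) Ks(2) by (auto simp: basic_set_append)
  also have "semialgebraic n \<dots>"
    using Ls(1) Ks(1) by (intro semialgebraic_UN semialgebraic_basic_set) auto
  finally show ?thesis .
qed

text \<open>Substituting \<open>g\<close> into each inequality describes the preimage. All later
  transformations are phrased as preimages, so no projection or quantifier elimination is
  involved.\<close>

lemma semialgebraic_vimage:
  assumes "semialgebraic n S"
    and g: "\<And>i. i < n \<Longrightarrow> alg_mpoly m (\<lambda>x. g x i)" "\<And>x. x \<in> Rn m \<Longrightarrow> g x \<in> Rn n"
  shows "semialgebraic m {x \<in> Rn m. g x \<in> S}"
proof -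
  obtain Ls where Ls: "\<forall>L\<in>set Ls. \<forall>(P, _)\<in>set L. alg_mpoly n P" "S = (\<Union>L\<in>set Ls. basic_set n L)"
    using assms(1) unfolding semialgebraic_def by blast
  define sub where "sub = map (\<lambda>(P :: (nat \<Rightarrow> real) \<Rightarrow> real, b :: bool). (\<lambda>x. P (g x), b))"
  have "{x \<in> Rn m. g x \<in> S} = (\<Union>L\<in>set Ls. basic_set m (sub L))"
    using g(2) unfolding Ls(2) basic_set_def sub_def by (auto split: prod.splits)
  also have "semialgebraic m \<dots>"
  proof (intro semialgebraic_UN semialgebraic_basic_set)
    fix L P b assume "L \<in> set Ls" "(P, b) \<in> set (sub L)"
    then show "alg_mpoly m P"
      using Ls(1) by (fastforce simp: sub_def intro!: alg_mpoly_subst[OF _ g(1)])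
  qed simp
  finally show ?thesis .
qed

lemma space_lebesgue_n: "space (lebesgue_n n) = Rn n"
  by (simp add: lebesgue_n_def space_PiM Rn_def)

lemma semialgebraic_sets:
  assumes "semialgebraic n S"
  shows "S \<in> sets (lebesgue_n n)"
proof -
  obtain Ls where Ls: "\<forall>L\<in>set Ls. \<forall>(P, _)\<in>set L. alg_mpoly n P" "S = (\<Union>L\<in>set Ls. basic_set n L)"
    using assms unfolding semialgebraic_def by blast
  have "basic_set n L \<in> sets (lebesgue_n n)" if "\<forall>(P, _)\<in>set L. alg_mpoly n P" for L
    using that
  proof (induction L)
    case Nil
    then show ?case using sets.top[of "lebesgue_n n"] by (simp add: basic_set_def space_lebesgue_n)
  next
    case (Cons a L)
    obtain P b where a: "a = (P, b)" by fastforce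
    have [measurable]: "P \<in> borel_measurable (lebesgue_n n)"
      using Cons.prems by (auto simp: a intro: borel_measurable_alg_mpoly)
    have "basic_set n [a] \<in> sets (lebesgue_n n)"
      unfolding basic_set_def a space_lebesgue_n[symmetric] by (cases b) simp_all
    then show ?case
      using Cons basic_set_append[of n "[a]" L] by auto
  qed
  then show ?thesis unfolding Ls(2) using Ls(1) by auto
qed

subsection \<open>Volumes by slicing\<close>

interpretation lborel_product: product_sigma_finite "\<lambda>_ :: nat. lborel :: real measure" ..

lemma fun_upd_in_Rn: "x \<in> Rn n \<Longrightarrow> k < n \<Longrightarrow> x(k := y) \<in> Rn n"
  by (auto simp: Rn_def PiE_def extensional_def)

text \<open>Tonelli's theorem with coordinate \<open>k\<close> split off: the inner integral is the
  length of a line section, the outer one runs over the other coordinates.\<close>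

lemma
  assumes "k < n" and S: "S \<in> sets (lebesgue_n n)"
  shows measurable_emeasure_slice:
      "(\<lambda>x. emeasure lborel {y. x(k := y) \<in> S}) \<in> borel_measurable (PiM ({..<n} - {k}) (\<lambda>_. lborel))"
    and emeasure_lebesgue_n_slice:
      "emeasure (lebesgue_n n) S =
         (\<integral>\<^sup>+x. emeasure lborel {y. x(k := y) \<in> S} \<partial>PiM ({..<n} - {k}) (\<lambda>_. lborel))"
    and slice_in_borel:
      "x \<in> space (PiM ({..<n} - {k}) (\<lambda>_. lborel)) \<Longrightarrow> {y. x(k := y) \<in> S} \<in> sets borel"
proof -
  let ?I = "{..<n} - {k}"
  have n: "{..<n} = insert k ?I" using assms(1) by auto
  have S': "S \<in> sets (PiM (insert k ?I) (\<lambda>_. lborel))"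
    using S n by (simp add: lebesgue_n_def)
  then have ind: "indicator S \<in> borel_measurable (PiM (insert k ?I) (\<lambda>_. lborel))"
    by simp
  have upd: "(\<lambda>(x, y). x(k := y)) \<in>
      measurable (PiM ?I (\<lambda>_. lborel) \<Otimes>\<^sub>M lborel) (PiM (insert k ?I) (\<lambda>_. lborel))"
    by (rule measurable_add_dim)
  have sl: "{y. x(k := y) \<in> S} \<in> sets borel" if "x \<in> space (PiM ?I (\<lambda>_. lborel))" for x
  proof -
    have "(\<lambda>y. x(k := y)) \<in> measurable lborel (PiM (insert k ?I) (\<lambda>_. lborel))"
      using measurable_compose[OF measurable_Pair1'[OF that] upd] by simp
    from measurable_sets[OF this S'] show ?thesis by (simp add: vimage_def)
  qed
  then show "x \<in> space (PiM ?I (\<lambda>_. lborel)) \<Longrightarrow> {y. x(k := y) \<in> S} \<in> sets borel" .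
  have eq: "(\<integral>\<^sup>+y. indicator S (x(k := y)) \<partial>lborel) = emeasure lborel {y. x(k := y) \<in> S}"
    if "x \<in> space (PiM ?I (\<lambda>_. lborel))" for x
  proof -
    have "(\<integral>\<^sup>+y. indicator S (x(k := y)) \<partial>lborel) = (\<integral>\<^sup>+y. indicator {y. x(k := y) \<in> S} y \<partial>lborel)"
      by (intro nn_integral_cong) (simp add: indicator_def)
    then show ?thesis using sl[OF that] by simp
  qed
  have "(\<lambda>x. \<integral>\<^sup>+y. indicator S (x(k := y)) \<partial>lborel) \<in> borel_measurable (PiM ?I (\<lambda>_. lborel))"
    using measurable_compose[OF upd ind]
    by (intro lborel.borel_measurable_nn_integral) (simp add: case_prod_beta')
  then show "(\<lambda>x. emeasure lborel {y. x(k := y) \<in> S}) \<in> borel_measurable (PiM ?I (\<lambda>_. lborel))"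
    by (subst measurable_cong[OF eq[symmetric]])
  have "emeasure (lebesgue_n n) S = (\<integral>\<^sup>+x. indicator S x \<partial>PiM (insert k ?I) (\<lambda>_. lborel))"
    using S' n by (simp add: lebesgue_n_def)
  also have "\<dots> = (\<integral>\<^sup>+x. \<integral>\<^sup>+y. indicator S (x(k := y)) \<partial>lborel \<partial>PiM ?I (\<lambda>_. lborel))"
    by (rule lborel_product.product_nn_integral_insert[OF _ _ ind]) auto
  also have "\<dots> = (\<integral>\<^sup>+x. emeasure lborel {y. x(k := y) \<in> S} \<partial>PiM ?I (\<lambda>_. lborel))"
    by (intro nn_integral_cong eq)
  finally show "emeasure (lebesgue_n n) S =
    (\<integral>\<^sup>+x. emeasure lborel {y. x(k := y) \<in> S} \<partial>PiM ?I (\<lambda>_. lborel))" .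
qed

text \<open>Cavalieri's principle, with a constant factor between corresponding sections.\<close>

lemma emeasure_eq_cmult_if_slices:
  assumes "k < n" "S \<in> sets (lebesgue_n n)" "T \<in> sets (lebesgue_n n)"
    and "\<And>x. {y. x(k := y) \<in> S} \<in> sets borel \<Longrightarrow> x \<in> space (PiM ({..<n} - {k}) (\<lambda>_. lborel)) \<Longrightarrow>
      emeasure lborel {y. x(k := y) \<in> T} = c * emeasure lborel {y. x(k := y) \<in> S}"
  shows "emeasure (lebesgue_n n) T = c * emeasure (lebesgue_n n) S"
proof -
  note emeasure_lebesgue_n_slice[OF assms(1,3)]
  also have "(\<integral>\<^sup>+x. emeasure lborel {y. x(k := y) \<in> T} \<partial>PiM ({..<n} - {k}) (\<lambda>_. lborel)) =
    (\<integral>\<^sup>+x. c * emeasure lborel {y. x(k := y) \<in> S} \<partial>PiM ({..<n} - {k}) (\<lambda>_. lborel))"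
    using slice_in_borel[OF assms(1,2)] assms(4) by (intro nn_integral_cong) blast
  also have "\<dots> = c * emeasure (lebesgue_n n) S"
    using assms(1,2)
    by (simp add: nn_integral_cmult measurable_emeasure_slice emeasure_lebesgue_n_slice)
  finally show ?thesis .
qed

lemma emeasure_lborel_affine_vimage:
  fixes c t :: real
  assumes [measurable]: "A \<in> sets borel" and "c \<noteq> 0"
  shows "emeasure lborel {y. t + c * y \<in> A} = ennreal (1 / \<bar>c\<bar>) * emeasure lborel A"
proof -
  have [measurable]: "{y. t + c * y \<in> A} \<in> sets borel" by measurable
  have "emeasure lborel A = (\<integral>\<^sup>+y. indicator A y \<partial>lborel)" by simp
  also have "\<dots> = \<bar>c\<bar> * (\<integral>\<^sup>+y. indicator A (t + c * y) \<partial>lborel)"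
    using assms(2) by (intro nn_integral_real_affine) measurable
  also have "(\<integral>\<^sup>+y. indicator A (t + c * y) \<partial>lborel) = (\<integral>\<^sup>+y. indicator {y. t + c * y \<in> A} y \<partial>lborel)"
    by (intro nn_integral_cong) (simp add: indicator_def)
  also have "\<dots> = emeasure lborel {y. t + c * y \<in> A}" by simp
  finally have "ennreal (1 / \<bar>c\<bar>) * emeasure lborel A
      = ennreal (1 / \<bar>c\<bar>) * ennreal \<bar>c\<bar> * emeasure lborel {y. t + c * y \<in> A}"
    by (simp add: mult.assoc)
  also have "ennreal (1 / \<bar>c\<bar>) * ennreal \<bar>c\<bar> = 1"
    using assms(2) by (simp flip: ennreal_mult')
  finally show ?thesis by simp
qed

text \<open>A constant \<open>P\<close> covers translations and stretchings; a \<open>P\<close> that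
  depends on another coordinate is what the linear pieces of a shear require.\<close>

lemma semialgebraic_affine_coord:
  assumes "semialgebraic n S" "k < n" "algebraic c" "c \<noteq> 0" "alg_mpoly n P"
  shows "semialgebraic n {x \<in> Rn n. x(k := P x + c * x k) \<in> S}"
proof (rule semialgebraic_vimage[OF assms(1)])
  show "alg_mpoly n (\<lambda>x. (x(k := P x + c * x k)) i)" if "i < n" for i
    using assms that
    by (cases "i = k") (auto intro!: alg_mpoly_add alg_mpoly_mult alg_mpoly_const alg_mpoly_coord)
qed (use assms in \<open>auto intro: fun_upd_in_Rn\<close>)

lemma upd_in_Rn:
  assumes "x \<in> space (PiM ({..<n} - {k}) (\<lambda>_. lborel))" "k < n"
  shows "x(k := y) \<in> Rn n"
  using assms by (auto simp: Rn_def space_PiM PiE_def extensional_def)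

lemma emeasure_affine_coord:
  assumes "semialgebraic n S" "k < n" "algebraic c" "c \<noteq> 0" "algebraic t"
  shows "emeasure (lebesgue_n n) {x \<in> Rn n. x(k := t + c * x k) \<in> S} =
    ennreal (1 / \<bar>c\<bar>) * emeasure (lebesgue_n n) S"
proof (rule emeasure_eq_cmult_if_slices[OF assms(2) semialgebraic_sets semialgebraic_sets])
  show "semialgebraic n {x \<in> Rn n. x(k := t + c * x k) \<in> S}"
    using assms by (intro semialgebraic_affine_coord alg_mpoly_const)
  fix x :: "nat \<Rightarrow> real"
  assume "{y. x(k := y) \<in> S} \<in> sets borel" "x \<in> space (PiM ({..<n} - {k}) (\<lambda>_. lborel))"
  then show "emeasure lborel {y. x(k := y) \<in> {x \<in> Rn n. x(k := t + c * x k) \<in> S}} =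
      ennreal (1 / \<bar>c\<bar>) * emeasure lborel {y. x(k := y) \<in> S}"
    using emeasure_lborel_affine_vimage[of "{y. x(k := y) \<in> S}" c t] assms(2,4)
    by (simp add: upd_in_Rn)
qed (fact assms(1))

lemma semialgebraic_cylinder:
  assumes "semialgebraic n S"
  shows "semialgebraic (Suc n) {x \<in> Rn (Suc n). restrict x {..<n} \<in> S \<and> x n \<in> {0..1}}"
    (is "semialgebraic _ ?T")
    and "emeasure (lebesgue_n (Suc n)) {x \<in> Rn (Suc n). restrict x {..<n} \<in> S \<and> x n \<in> {0..1}} =
      emeasure (lebesgue_n n) S"
proof -
  have "?T = {x \<in> Rn (Suc n). restrict x {..<n} \<in> S} \<inter>
      ({x \<in> Rn (Suc n). x n \<ge> 0} \<inter> {x \<in> Rn (Suc n). 1 - x n \<ge> 0})" by auto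
  also have "semialgebraic (Suc n) \<dots>"
    by (intro semialgebraic_Int semialgebraic_vimage[OF assms] semialgebraic_nonneg
          alg_mpoly_diff alg_mpoly_const alg_mpoly_coord algebraic_1)
       (auto intro: alg_mpoly_coord simp: Rn_def)
  finally show T: "semialgebraic (Suc n) ?T" .
  have I: "{..<Suc n} - {n} = {..<n}" by auto
  have S: "S \<in> sets (PiM {..<n} (\<lambda>_. lborel))"
    using semialgebraic_sets[OF assms] by (simp add: lebesgue_n_def)
  \<comment> \<open>Sections in the new direction are the unit interval over \<open>S\<close> and
    empty elsewhere, so the outer integrand is the indicator of \<open>S\<close>.\<close>
  have "{y. x(n := y) \<in> ?T} = (if x \<in> S then {0..1} else {})"
    if "x \<in> space (PiM {..<n} (\<lambda>_. lborel))" for x :: "nat \<Rightarrow> real"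
  proof -
    have "restrict (x(n := y)) {..<n} = x" for y
      using that by (auto simp: space_PiM PiE_def extensional_def restrict_def fun_eq_iff)
    then show ?thesis using upd_in_Rn[of x "Suc n" n] that by (auto simp: I)
  qed
  then have "emeasure (lebesgue_n (Suc n)) ?T = (\<integral>\<^sup>+x. indicator S x \<partial>PiM {..<n} (\<lambda>_. lborel))"
    by (subst emeasure_lebesgue_n_slice[of n, OF _ semialgebraic_sets[OF T]])
       (auto simp: I intro!: nn_integral_cong)
  also have "\<dots> = emeasure (lebesgue_n n) S" using S by (simp add: lebesgue_n_def)
  finally show "emeasure (lebesgue_n (Suc n)) ?T = emeasure (lebesgue_n n) S" .
qed

text \<open>Restricted to \<open>\<bar>x l\<bar> < \<bar>x k\<bar>\<close>, this map is injective, preserves the volume and reaches every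
  point with \<open>x k \<noteq> 0\<close>. Pulling sets back along it therefore squeezes the whole space into the double
  cone \<open>\<bar>x l\<bar> < \<bar>x k\<bar>\<close>, and the cone with \<open>k\<close> and \<open>l\<close> exchanged leaves room for a second copy.\<close>

definition shear :: "nat \<Rightarrow> nat \<Rightarrow> (nat \<Rightarrow> real) \<Rightarrow> nat \<Rightarrow> real" where
  "shear k l x = x(k := x k - sgn (x k) * \<bar>x l\<bar>)"

lemma semialgebraic_shear:
  assumes S: "semialgebraic n S" and "k < n" "l < n" "k \<noteq> l"
  shows "semialgebraic n {x \<in> Rn n. \<bar>x l\<bar> < \<bar>x k\<bar> \<and> shear k l x \<in> S}" (is "semialgebraic n ?T")
proof -
  \<comment> \<open>\<open>sgn\<close> and the absolute value are not polynomial, so the set is cut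
    by signs. The first two conditions force \<open>t * x l = \<bar>x l\<bar>\<close>,
    \<open>s = sgn (x k)\<close> and \<open>\<bar>x l\<bar> < \<bar>x k\<bar>\<close>; on such a
    piece the shear is linear.\<close>
  define U where "U s t = {x \<in> Rn n. t * x l \<ge> 0} \<inter> {x \<in> Rn n. s * x k - t * x l > 0} \<inter>
    {x \<in> Rn n. x(k := - (s * t * x l) + 1 * x k) \<in> S}" for s t :: real
  have "?T = (\<Union>s\<in>{1, -1}. \<Union>t\<in>{1, -1}. U s t)"
  proof (rule set_eqI)
    fix x
    show "x \<in> ?T \<longleftrightarrow> x \<in> (\<Union>s\<in>{1, -1}. \<Union>t\<in>{1, -1}. U s t)"
    proof (cases "0 \<le> x l"; cases "x k" "0 :: real" rule: linorder_cases)
    qed (auto simp: U_def shear_def algebra_simps)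
  qed
  also have "semialgebraic n \<dots>"
    unfolding U_def using assms
    by (intro semialgebraic_UN semialgebraic_Int semialgebraic_affine_coord semialgebraic_pos
          semialgebraic_nonneg)
       (auto intro!: alg_mpoly_minus alg_mpoly_diff alg_mpoly_mult alg_mpoly_const alg_mpoly_coord)
  finally show ?thesis .
qed

text \<open>The rays beyond \<open>\<bar>b\<bar>\<close> and below \<open>- \<bar>b\<bar>\<close>
  are translated onto the positive and the negative half-line. Only the point 0 is missed, which is
  a null set.\<close>

lemma emeasure_lborel_shear_slice:
  fixes b :: real
  assumes [measurable]: "A \<in> sets borel"
  shows "emeasure lborel {y. \<bar>b\<bar> < \<bar>y\<bar> \<and> y - sgn y * \<bar>b\<bar> \<in> A} = emeasure lborel A"
proof -
  have [measurable]: "{y. - \<bar>b\<bar> + 1 * y \<in> A \<inter> {0<..}} \<in> sets borel"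
      "{y. \<bar>b\<bar> + 1 * y \<in> A \<inter> {..<0}} \<in> sets borel"
    by measurable
  have "{y. \<bar>b\<bar> < \<bar>y\<bar> \<and> y - sgn y * \<bar>b\<bar> \<in> A} =
      {y. - \<bar>b\<bar> + 1 * y \<in> A \<inter> {0<..}} \<union> {y. \<bar>b\<bar> + 1 * y \<in> A \<inter> {..<0}}"
    by (auto simp: sgn_if abs_if algebra_simps split: if_splits)
  also have "emeasure lborel \<dots> = emeasure lborel {y. - \<bar>b\<bar> + 1 * y \<in> A \<inter> {0<..}} +
      emeasure lborel {y. \<bar>b\<bar> + 1 * y \<in> A \<inter> {..<0}}"
    by (intro plus_emeasure[symmetric]) auto
  also have "\<dots> = emeasure lborel (A \<inter> {0<..}) + emeasure lborel (A \<inter> {..<0})"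
    by (subst (1 2) emeasure_lborel_affine_vimage) auto
  also have "\<dots> = emeasure lborel (A \<inter> {0<..} \<union> A \<inter> {..<0})"
    by (intro plus_emeasure) auto
  also have "A \<inter> {0<..} \<union> A \<inter> {..<0} = A - {0}" by auto
  also have "emeasure lborel (A - {0}) = emeasure lborel A"
    by (intro emeasure_Diff_null_set) auto
  finally show ?thesis .
qed

text \<open>On a line in direction \<open>k\<close> the value \<open>x l\<close> is fixed because
  \<open>k \<noteq> l\<close>, so each section is an instance of the one-dimensional
  statement.\<close>

lemma emeasure_shear:
  assumes S: "semialgebraic n S" and kl: "k < n" "l < n" "k \<noteq> l"
  shows "emeasure (lebesgue_n n) {x \<in> Rn n. \<bar>x l\<bar> < \<bar>x k\<bar> \<and> shear k l x \<in> S} =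
    emeasure (lebesgue_n n) S"
proof -
  have "emeasure (lebesgue_n n) {x \<in> Rn n. \<bar>x l\<bar> < \<bar>x k\<bar> \<and> shear k l x \<in> S} =
      1 * emeasure (lebesgue_n n) S"
  proof (rule emeasure_eq_cmult_if_slices[OF kl(1) semialgebraic_sets semialgebraic_sets])
    show "semialgebraic n {x \<in> Rn n. \<bar>x l\<bar> < \<bar>x k\<bar> \<and> shear k l x \<in> S}"
      using assms by (rule semialgebraic_shear)
    fix x :: "nat \<Rightarrow> real"
    assume "{y. x(k := y) \<in> S} \<in> sets borel" "x \<in> space (PiM ({..<n} - {k}) (\<lambda>_. lborel))"
    then show "emeasure lborel {y. x(k := y) \<in> {x \<in> Rn n. \<bar>x l\<bar> < \<bar>x k\<bar> \<and> shear k l x \<in> S}} =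
        1 * emeasure lborel {y. x(k := y) \<in> S}"
      using emeasure_lborel_shear_slice[of "{y. x(k := y) \<in> S}" "x l"] kl
      by (simp add: upd_in_Rn shear_def)
  qed (fact S)
  then show ?thesis by simp
qed

subsection \<open>Semialgebraic subsets of the line\<close>

text \<open>Having a definite truth value near the limit is, unlike being eventually true, stable
  under negation and disjunction, and polynomial inequalities on the line have it.\<close>

definition eventually_const :: "('a \<Rightarrow> bool) \<Rightarrow> 'a filter \<Rightarrow> bool" where
  "eventually_const P F \<longleftrightarrow> (\<forall>\<^sub>F x in F. P x) \<or> (\<forall>\<^sub>F x in F. \<not> P x)"

lemma eventually_const_not: "eventually_const P F \<Longrightarrow> eventually_const (\<lambda>x. \<not> P x) F"
  by (auto simp: eventually_const_def)

lemma eventually_const_conj: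
  assumes "eventually_const P F" "eventually_const Q F"
  shows "eventually_const (\<lambda>x. P x \<and> Q x) F"
proof (cases "(\<forall>\<^sub>F x in F. P x) \<and> (\<forall>\<^sub>F x in F. Q x)")
  case True
  then show ?thesis by (simp add: eventually_const_def eventually_conj_iff)
next
  case False
  then have "(\<forall>\<^sub>F x in F. \<not> P x) \<or> (\<forall>\<^sub>F x in F. \<not> Q x)"
    using assms by (auto simp: eventually_const_def)
  then have "\<forall>\<^sub>F x in F. \<not> (P x \<and> Q x)"
    by (auto elim: eventually_mono)
  then show ?thesis by (simp add: eventually_const_def)
qed

lemma eventually_const_disj:
  assumes "eventually_const P F" "eventually_const Q F"
  shows "eventually_const (\<lambda>x. P x \<or> Q x) F"
  using eventually_const_not[OF eventually_const_conj[OF assms[THEN eventually_const_not]]] by simp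

lemma eventually_const_poly_pos:
  fixes p :: "real poly"
  shows "eventually_const (\<lambda>y. poly p y > 0) at_top"
proof -
  \<comment> \<open>Near infinity the sign of a polynomial is that of its leading coefficient;
    \<open>p\<close> and \<open>- p\<close> cover both nonzero signs.\<close>
  have *: "\<forall>\<^sub>F y in at_top. poly q y > 0" if q: "lead_coeff q > 0" for q :: "real poly"
  proof -
    obtain b where "\<And>y. y \<ge> b \<Longrightarrow> poly q y \<ge> lead_coeff q"
      using poly_pinfty_gt_lc[OF q] by blast
    then show ?thesis using q unfolding eventually_at_top_linorder by (meson less_le_trans)
  qed
  show ?thesis
  proof (cases "lead_coeff p" "0 :: real" rule: linorder_cases)
    case less
    then have "\<forall>\<^sub>F y in at_top. poly p y < 0" using *[of "- p"] by simp
    then have "\<forall>\<^sub>F y in at_top. \<not> poly p y > 0" by eventually_elim simp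
    then show ?thesis by (simp add: eventually_const_def)
  next
    case equal
    then show ?thesis by (simp add: eventually_const_def)
  next
    case greater
    then show ?thesis using *[of p] by (simp add: eventually_const_def)
  qed
qed

lemma eventually_const_poly_nonneg:
  fixes p :: "real poly"
  shows "eventually_const (\<lambda>y. poly p y \<ge> 0) at_top"
  using eventually_const_not[OF eventually_const_poly_pos[of "- p"]] by (simp add: not_less)

lemma alg_mpoly_1_poly:
  assumes "alg_mpoly 1 P"
  obtains p :: "real poly" where "\<And>x. P x = poly p (x 0)"
proof -
  obtain M c where P: "\<And>x. P x = (\<Sum>m\<in>M. c m * (\<Prod>i<1. x i ^ m i))"
    using assms unfolding alg_mpoly_def by blast
  have "P x = poly (\<Sum>m\<in>M. monom (c m) (m 0)) (x 0)" for x
    unfolding P by (simp add: poly_sum poly_monom)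
  then show thesis using that by blast
qed

text \<open>Identifies the line with \<open>Rn 1\<close>, whose elements are extensional functions
  and so are \<open>undefined\<close> off index 0.\<close>

definition embed1 :: "real \<Rightarrow> nat \<Rightarrow> real" where
  "embed1 y = (\<lambda>_. undefined)(0 := y)"

lemma embed1_0 [simp]: "embed1 y 0 = y"
  by (simp add: embed1_def)

lemma embed1_upd [simp]: "(embed1 y)(0 := z) = embed1 z"
  by (simp add: embed1_def)

lemma Rn_1: "x \<in> Rn 1 \<longleftrightarrow> x = embed1 (x 0)"
  by (auto simp: embed1_def Rn_def PiE_def extensional_def fun_eq_iff)

lemma embed1_in_Rn [simp]: "embed1 y \<in> Rn (Suc 0)"
  using Rn_1[of "embed1 y"] by simp

lemma semialgebraic_1_eventually_const:
  assumes "semialgebraic 1 S"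
  shows "eventually_const (\<lambda>y. embed1 y \<in> S) at_top"
proof -
  have basic: "eventually_const (\<lambda>y. embed1 y \<in> basic_set 1 L) at_top"
    if "\<forall>(P, _)\<in>set L. alg_mpoly 1 P" for L
    using that
  proof (induction L)
    case Nil
    then show ?case by (simp add: basic_set_def eventually_const_def)
  next
    case (Cons a L)
    obtain P b where a: "a = (P, b)" by fastforce
    obtain p where p: "\<And>x. P x = poly p (x 0)"
      using Cons.prems alg_mpoly_1_poly[of P] by (auto simp: a)
    have "eventually_const (\<lambda>y. embed1 y \<in> basic_set 1 [a]) at_top"
      using eventually_const_poly_pos[of p] eventually_const_poly_nonneg[of p]
      by (cases b) (simp_all add: a p basic_set_def)
    moreover have "eventually_const (\<lambda>y. embed1 y \<in> basic_set 1 L) at_top"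
      using Cons.IH Cons.prems by auto
    moreover have "basic_set 1 (a # L) = basic_set 1 [a] \<inter> basic_set 1 L"
      using basic_set_append[of 1 "[a]" L] by simp
    ultimately show ?case using eventually_const_conj by auto
  qed
  obtain Ls where Ls: "\<forall>L\<in>set Ls. \<forall>(P, _)\<in>set L. alg_mpoly 1 P" "S = (\<Union>L\<in>set Ls. basic_set 1 L)"
    using assms unfolding semialgebraic_def by blast
  show ?thesis unfolding Ls(2) using Ls(1)
  proof (induction Ls)
    case Nil
    then show ?case by (simp add: eventually_const_def)
  next
    case (Cons L Ls)
    then show ?case using eventually_const_disj[OF basic[of L]] by auto
  qed
qed

text \<open>Membership is eventually constant; were it eventually true, \<open>S\<close> would
  contain a half-line and have infinite measure.\<close>

lemma semialgebraic_1_bounded_above: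
  assumes S: "semialgebraic 1 S" "emeasure (lebesgue_n 1) S < \<infinity>"
  shows "\<forall>\<^sub>F y in at_top. embed1 y \<notin> S"
proof (rule ccontr)
  assume "\<not> ?thesis"
  then have "\<forall>\<^sub>F y in at_top. embed1 y \<in> S"
    using semialgebraic_1_eventually_const[OF S(1)] by (simp add: eventually_const_def)
  then obtain b where b: "\<And>y. y \<ge> b \<Longrightarrow> embed1 y \<in> S"
    unfolding eventually_at_top_linorder by blast
  have I: "{..<Suc 0} - {0::nat} = {}" by auto
  have "{y. embed1 y \<in> S} \<in> sets borel"
    using slice_in_borel[OF _ semialgebraic_sets[OF S(1)], of 0 "\<lambda>_. undefined"]
    by (simp add: space_PiM embed1_def PiE_def extensional_def)
  then have *: "emeasure lborel {b..b + real k} \<le> emeasure lborel {y. embed1 y \<in> S}" for k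
    using b by (intro emeasure_mono) auto
  \<comment> \<open>Removing the only coordinate leaves the empty product, a one-point space of mass
    1, so the outer integral is a single section length.\<close>
  have "emeasure (lebesgue_n 1) S = emeasure lborel {y. embed1 y \<in> S}"
    by (subst emeasure_lebesgue_n_slice[OF _ semialgebraic_sets[OF S(1)], of 0])
       (simp_all add: I PiM_empty embed1_def fun_upd_def nn_integral_count_space_finite)
  then have "emeasure lborel {y. embed1 y \<in> S} < \<infinity>" using S(2) by simp
  then obtain r where r: "emeasure lborel {y. embed1 y \<in> S} = ennreal r" "r \<ge> 0"
    by (cases "emeasure lborel {y. embed1 y \<in> S}") auto
  obtain k where "r < real k" using reals_Archimedean2 by blast
  then show False using *[of k] r by simp
qed

text \<open>The upper bound is applied to \<open>S\<close> and to its reflection. The bound is taken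
  to be a natural number so that translating by it keeps coefficients algebraic.\<close>

lemma semialgebraic_1_bounded:
  assumes S: "semialgebraic 1 S" "emeasure (lebesgue_n 1) S < \<infinity>"
  obtains N :: nat where "\<And>x. x \<in> S \<Longrightarrow> \<bar>x 0\<bar> < N"
proof -
  let ?R = "{x \<in> Rn 1. x(0 := 0 + (-1) * x 0) \<in> S}"
  have R: "semialgebraic 1 ?R"
    by (intro semialgebraic_affine_coord[OF S(1)] alg_mpoly_const) auto
  have "emeasure (lebesgue_n 1) ?R < \<infinity>"
    using emeasure_affine_coord[OF S(1), of 0 "-1" 0] S(2) by simp
  from semialgebraic_1_bounded_above[OF R this] semialgebraic_1_bounded_above[OF S]
  have "\<forall>\<^sub>F y in at_top. embed1 y \<notin> S \<and> embed1 y \<notin> ?R"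
    by eventually_elim auto
  then obtain b where b: "\<And>y. y \<ge> b \<Longrightarrow> embed1 y \<notin> S \<and> embed1 y \<notin> ?R"
    unfolding eventually_at_top_linorder by blast
  obtain N where N: "b < real N" using reals_Archimedean2 by blast
  have "\<bar>x 0\<bar> < N" if "x \<in> S" for x
  proof (rule ccontr)
    assume *: "\<not> \<bar>x 0\<bar> < N"
    have x: "x = embed1 (x 0)" using that semialgebraic_subset[OF S(1)] Rn_1 by blast
    show False
    proof (cases "x 0 \<ge> 0")
      case True
      then show ?thesis using b[of "x 0"] * N that x by auto
    next
      case False
      then have "embed1 (- x 0) \<notin> ?R" using b[of "- x 0"] * N by auto
      then show ?thesis using that x by auto
    qed
  qed
  then show thesis using that by blast
qed

subsection \<open>Periods of a given dimension\<close>

text \<open>The shears need two coordinates. On the line, a set of finite measure is bounded, so translations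
  separate the copies.\<close>

lemma disjoint_copies:
  assumes "n \<ge> 1" and S: "admissible_domain n S" "admissible_domain n S'"
  obtains T T' where "semialgebraic n T" "semialgebraic n T'" "T \<inter> T' = {}"
    "emeasure (lebesgue_n n) T = emeasure (lebesgue_n n) S"
    "emeasure (lebesgue_n n) T' = emeasure (lebesgue_n n) S'"
proof (cases "n = 1")
  case True
  note S = S[unfolded True admissible_domain_iff]
  obtain N N' where N: "\<And>x. x \<in> S \<Longrightarrow> \<bar>x 0\<bar> < real N" "\<And>x. x \<in> S' \<Longrightarrow> \<bar>x 0\<bar> < real N'"
    using semialgebraic_1_bounded S by metis
  let ?T = "{x \<in> Rn 1. x(0 := real N + 1 * x 0) \<in> S}"
  let ?T' = "{x \<in> Rn 1. x(0 := - real N' + 1 * x 0) \<in> S'}"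
  \<comment> \<open>The shifts place \<open>?T\<close> in \<open>x 0 < 0\<close> and
    \<open>?T'\<close> in \<open>x 0 > 0\<close>.\<close>
  have "?T \<inter> ?T' = {}" using N by fastforce
  moreover have "semialgebraic 1 ?T" "semialgebraic 1 ?T'"
    using S by (intro semialgebraic_affine_coord alg_mpoly_const; auto)+
  moreover have "emeasure (lebesgue_n 1) ?T = emeasure (lebesgue_n 1) S"
    "emeasure (lebesgue_n 1) ?T' = emeasure (lebesgue_n 1) S'"
    using S emeasure_affine_coord[of 1 S 0 1 "real N"]
      emeasure_affine_coord[of 1 S' 0 1 "- real N'"] by auto
  ultimately show thesis using that unfolding True by blast
next
  case False
  let ?T = "{x \<in> Rn n. \<bar>x 1\<bar> < \<bar>x 0\<bar> \<and> shear 0 1 x \<in> S}"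
  let ?T' = "{x \<in> Rn n. \<bar>x 0\<bar> < \<bar>x 1\<bar> \<and> shear 1 0 x \<in> S'}"
  have "?T \<inter> ?T' = {}" by auto
  moreover have "semialgebraic n ?T" "semialgebraic n ?T'"
    "emeasure (lebesgue_n n) ?T = emeasure (lebesgue_n n) S"
    "emeasure (lebesgue_n n) ?T' = emeasure (lebesgue_n n) S'"
    using S False assms(1)
    by (auto simp: admissible_domain_iff intro!: semialgebraic_shear emeasure_shear)
  ultimately show thesis using that by blast
qed

lemma admissible_domain_sum:
  assumes "n \<ge> 1" and S: "admissible_domain n S" "admissible_domain n S'"
  obtains T where "admissible_domain n T" "vol n T = vol n S + vol n S'"
proof -
  obtain T T' where T: "semialgebraic n T" "semialgebraic n T'" "T \<inter> T' = {}"
    "emeasure (lebesgue_n n) T = emeasure (lebesgue_n n) S"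
    "emeasure (lebesgue_n n) T' = emeasure (lebesgue_n n) S'"
    using disjoint_copies assms by blast
  have eq: "emeasure (lebesgue_n n) (T \<union> T') = emeasure (lebesgue_n n) S + emeasure (lebesgue_n n) S'"
    using T by (simp add: plus_emeasure[symmetric] semialgebraic_sets)
  show thesis
  proof (rule that)
    show "admissible_domain n (T \<union> T')"
      using S T(1,2) eq by (simp add: admissible_domain_iff semialgebraic_Un)
    show "vol n (T \<union> T') = vol n S + vol n S'"
      using S eq by (simp add: vol_def measure_def admissible_domain_iff enn2real_plus)
  qed
qed

lemma period_in_dim_add:
  assumes "n \<ge> 1" "period_in_dim n p" "period_in_dim n q"
  shows "period_in_dim n (p + q)"
proof -
  obtain A B C D where "admissible_domain n A" "admissible_domain n B" "p = vol n A - vol n B"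
    "admissible_domain n C" "admissible_domain n D" "q = vol n C - vol n D"
    using assms(2,3) unfolding period_in_dim_def by blast
  moreover from this obtain S T where "admissible_domain n S" "vol n S = vol n A + vol n C"
    "admissible_domain n T" "vol n T = vol n B + vol n D"
    using admissible_domain_sum[OF assms(1)] by metis
  ultimately show ?thesis unfolding period_in_dim_def by (intro exI[of _ S] exI[of _ T]) auto
qed

lemma period_in_dim_minus: "period_in_dim n p \<Longrightarrow> period_in_dim n (- p)"
  unfolding period_in_dim_def by (metis minus_diff_eq)

text \<open>Stretching a single coordinate by \<open>c\<close> multiplies the volume by exactly
  \<open>c\<close>. As a preimage this uses \<open>inverse c\<close>.\<close>

lemma admissible_domain_scale:
  assumes "n \<ge> 1" "admissible_domain n S" "algebraic c" "c > 0"
  obtains T where "admissible_domain n T" "vol n T = c * vol n S"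
proof
  let ?T = "{x \<in> Rn n. x(0 := 0 + inverse c * x 0) \<in> S}"
  have S: "semialgebraic n S" "emeasure (lebesgue_n n) S < \<infinity>"
    using assms(2) by (auto simp: admissible_domain_iff)
  have eq: "emeasure (lebesgue_n n) ?T = ennreal c * emeasure (lebesgue_n n) S"
    using emeasure_affine_coord[OF S(1), of 0 "inverse c" 0] assms
    by (auto simp: algebraic_inverse divide_inverse)
  have "semialgebraic n ?T"
    using assms S(1) by (intro semialgebraic_affine_coord alg_mpoly_const) auto
  then show "admissible_domain n ?T"
    using S(2) eq by (simp add: admissible_domain_iff ennreal_mult_less_top)
  show "vol n ?T = c * vol n S"
    using eq assms(4) by (simp add: vol_def measure_def enn2real_mult)
qed

lemma period_in_dim_0: "period_in_dim n 0"
  unfolding period_in_dim_def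
  by (rule exI[of _ "{}"], rule exI[of _ "{}"])
     (simp add: admissible_domain_iff semialgebraic_empty)

text \<open>Positive factors stretch both domains; a negative sign exchanges them.\<close>

lemma period_in_dim_algebraic_mult:
  assumes "n \<ge> 1" "period_in_dim n p" "algebraic c"
  shows "period_in_dim n (c * p)"
proof -
  have pos: "period_in_dim n (c * p)" if c: "algebraic c" "c > 0" for c
  proof -
    obtain A B where AB: "admissible_domain n A" "admissible_domain n B" "p = vol n A - vol n B"
      using assms(2) unfolding period_in_dim_def by blast
    obtain S where "admissible_domain n S" "vol n S = c * vol n A"
      using admissible_domain_scale[OF assms(1) AB(1) c] by blast
    moreover obtain T where "admissible_domain n T" "vol n T = c * vol n B"
      using admissible_domain_scale[OF assms(1) AB(2) c] by blast
    ultimately show ?thesis unfolding period_in_dim_def AB(3)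
      by (intro exI[of _ S] exI[of _ T]) (auto simp: algebra_simps)
  qed
  show ?thesis
  proof (cases c "0 :: real" rule: linorder_cases)
    case less
    then show ?thesis using period_in_dim_minus[OF pos[of "- c"]] assms(3) by simp
  next
    case equal
    then show ?thesis by (simp add: period_in_dim_0)
  next
    case greater
    then show ?thesis using pos assms(3) by blast
  qed
qed

text \<open>The product of a domain with the unit interval has the same volume.\<close>

lemma period_in_dim_Suc:
  assumes "period_in_dim n p"
  shows "period_in_dim (Suc n) p"
proof -
  have "\<exists>T. admissible_domain (Suc n) T \<and> vol (Suc n) T = vol n S" if "admissible_domain n S" for S
  proof (intro exI conjI)
    let ?T = "{x \<in> Rn (Suc n). restrict x {..<n} \<in> S \<and> x n \<in> {0..1}}"
    have S: "semialgebraic n S" "emeasure (lebesgue_n n) S < \<infinity>"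
      using that by (simp_all add: admissible_domain_iff)
    show "admissible_domain (Suc n) ?T" "vol (Suc n) ?T = vol n S"
      using semialgebraic_cylinder[OF S(1)] S(2)
      by (simp_all only: admissible_domain_iff vol_def measure_def simp_thms)
  qed
  then show ?thesis using assms unfolding period_in_dim_def by metis
qed

lemma period_in_dim_mono: "m \<le> n \<Longrightarrow> period_in_dim m p \<Longrightarrow> period_in_dim n p"
  by (induction rule: dec_induct) (auto intro: period_in_dim_Suc)

lemma period_in_dim_algebraic:
  assumes "n \<ge> 1" "algebraic c"
  shows "period_in_dim n c"
proof -
  \<comment> \<open>The one-point space in dimension 0 has volume 1. Passing to cylinders makes 1 a
    difference of volumes in dimension \<open>n\<close>, and scaling gives \<open>c\<close>.\<close>
  have "Rn 0 = {\<lambda>_. undefined}" by (simp add: Rn_def)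
  then have "emeasure (lebesgue_n 0) (Rn 0) = 1"
    by (simp add: lebesgue_n_def PiM_empty)
  then have "admissible_domain 0 (Rn 0)" "vol 0 (Rn 0) = 1"
    by (simp_all add: admissible_domain_iff semialgebraic_Rn vol_def measure_def)
  moreover have "admissible_domain 0 {}" "vol 0 {} = 0"
    by (simp_all add: admissible_domain_iff semialgebraic_empty vol_def)
  ultimately have "period_in_dim 0 1" unfolding period_in_dim_def by (metis diff_zero)
  from period_in_dim_algebraic_mult[OF assms(1) period_in_dim_mono[OF _ this] assms(2)]
  show ?thesis by simp
qed

section \<open>From dimensions to degrees\<close>

lemma real_period_deg_le:
  assumes "period_in_dim n p" "n \<ge> 1"
  shows "real_period_deg p \<le> n"
  using assms by (auto simp: real_period_deg_def intro: Least_le)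

lemma period_in_dim_if_real_period_deg_le:
  assumes "real_period p" "real_period_deg p \<le> n"
  shows "period_in_dim n p"
\<comment> \<open>The degree 0 of the number 0 is a convention rather than a minimum, but 0 is a
  difference of empty domains in every dimension.\<close>
proof (cases "p = 0")
  case True
  then show ?thesis by (simp add: period_in_dim_0)
next
  case False
  have "\<exists>n. n \<ge> 1 \<and> period_in_dim n p" using assms(1) unfolding real_period_def by blast
  from LeastI_ex[OF this] have "period_in_dim (real_period_deg p) p"
    using False by (simp add: real_period_deg_def)
  then show ?thesis using assms(2) period_in_dim_mono by blast
qed

lemma real_period_deg_pos:
  assumes "real_period p" "p \<noteq> 0"
  shows "real_period_deg p \<ge> 1"
proof -
  have "\<exists>n. n \<ge> 1 \<and> period_in_dim n p" using assms(1) unfolding real_period_def by blast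
  from LeastI_ex[OF this] show ?thesis using assms(2) by (simp add: real_period_deg_def)
qed

text \<open>Replaces the least dimension by membership in spaces closed under algebraic linear
  combinations.\<close>

lemma period_deg_le_iff:
  assumes "n \<ge> 1"
  shows "period_deg z \<le> enat n \<longleftrightarrow> period_in_dim n (Re z) \<and> period_in_dim n (Im z)"
proof
  assume "period_deg z \<le> enat n"
  then show "period_in_dim n (Re z) \<and> period_in_dim n (Im z)"
    by (auto simp: period_deg_def period_def period_in_dim_0 split: if_splits
      intro: period_in_dim_if_real_period_deg_le)
next
  assume *: "period_in_dim n (Re z) \<and> period_in_dim n (Im z)"
  then have "period z" using assms by (auto simp: period_def real_period_def)
  then show "period_deg z \<le> enat n"
    using * assms by (auto simp: period_deg_def real_period_deg_le)
qed

text \<open>The real and imaginary parts of \<open>a * z + b\<close> are combinations of those of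
  \<open>z\<close> with real algebraic coefficients. For \<open>z \<noteq> 0\<close> the degree is
  at least 1, which leaves room for the constant \<open>b\<close>; at \<open>z = 0\<close> the bound
  would fail for \<open>b = 1\<close>.\<close>

lemma period_deg_affine_le:
  assumes z: "period z" "z \<noteq> 0" and "algebraic a" "algebraic b"
  shows "period_deg (a * z + b) \<le> period_deg z"
proof -
  obtain n where n: "period_deg z = enat n" "n \<ge> 1"
  proof
    show "period_deg z = enat (max (real_period_deg (Re z)) (real_period_deg (Im z)))"
      using z by (simp add: period_deg_def)
    show "max (real_period_deg (Re z)) (real_period_deg (Im z)) \<ge> 1"
      using z real_period_deg_pos[of "Re z"] real_period_deg_pos[of "Im z"]
      by (auto simp: period_def complex_eq_iff le_max_iff_disj)
  qed
  then have p: "period_in_dim n (Re z)" "period_in_dim n (Im z)"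
    using period_deg_le_iff[OF n(2), of z] by simp_all
  note intros = period_in_dim_add period_in_dim_algebraic_mult[OF n(2)] p
    period_in_dim_algebraic[OF n(2) algebraic_Re] period_in_dim_algebraic[OF n(2) algebraic_Im]
    algebraic_minus algebraic_Re algebraic_Im n(2) assms(3,4)
  \<comment> \<open>The difference is written as a sum with \<open>- Im a\<close> so that the
    closure rules match syntactically.\<close>
  have "period_in_dim n (Re a * Re z + - Im a * Im z + Re b)"
    by (intro intros)
  moreover have "period_in_dim n (Re a * Im z + Im a * Re z + Im b)"
    by (intro intros)
  ultimately show ?thesis unfolding n(1) period_deg_le_iff[OF n(2)] by simp
qed

theorem theorem5p2:
  fixes p1 p2 :: complex
  assumes "period p1" and "period p2"
    and "\<not> algebraic p1" and "\<not> algebraic p2"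
    and "period_deg p1 \<noteq> period_deg p2"
  shows "\<not> algebraic (p1 / p2) \<and> \<not> algebraic (p1 + p2)"
proof -
  have nz: "p1 \<noteq> 0" "p2 \<noteq> 0" using assms(3,4) by auto
  have False if c: "algebraic c" "c = p1 / p2" for c
  proof -
    \<comment> \<open>Multiplication by \<open>c\<close> and by \<open>inverse c\<close> carries
      \<open>p2\<close> to \<open>p1\<close> and back, so the degree inequality holds both
      ways.\<close>
    have "period_deg (c * p2 + 0) \<le> period_deg p2"
      using assms(2) nz c(1) by (intro period_deg_affine_le algebraic_0)
    moreover have "period_deg (inverse c * p1 + 0) \<le> period_deg p1"
      using assms(1) nz c(1) by (intro period_deg_affine_le algebraic_0 algebraic_inverse)
    moreover have "c * p2 = p1" "inverse c * p1 = p2" using c(2) nz by simp_all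
    ultimately show False using assms(5) by simp
  qed
  moreover have False if c: "algebraic c" "c = p1 + p2" for c
  proof -
    \<comment> \<open>The map sending \<open>z\<close> to \<open>c - z\<close> is an involution that
      exchanges \<open>p1\<close> and \<open>p2\<close>.\<close>
    have "period_deg (- 1 * p2 + c) \<le> period_deg p2"
      using assms(2) nz c(1) by (intro period_deg_affine_le algebraic_minus algebraic_1)
    moreover have "period_deg (- 1 * p1 + c) \<le> period_deg p1"
      using assms(1) nz c(1) by (intro period_deg_affine_le algebraic_minus algebraic_1)
    ultimately show False using assms(5) c(2) by simp
  qed
  ultimately show ?thesis by blast
qed

end
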